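(* The type $A$ Eulerian descent algebra $\mathcal{E}_A=\mathrm{span}_{\mathbb{Q}}\{A_0,\ldots,A_{n-1}\}$ is a two-sided ideal in the flag descent algebra $\mathcal{F}=\mathrm{span}_{\mathbb{Q}}\{F_0,\ldots,F_{2n-1}\}$.
   Context: Let $n\ge 1$. The hyperoctahedral group $\mathfrak{B}_n$ is the group (under composition of functions) of all bijections $\pi$ of $\{-n,\ldots,-1,0,1,\ldots,n\}$ with $\pi(-i)=-\pi(i)$ for all $i$. For $\pi\in\mathfrak{B}_n$, $\mathrm{des}_A(\pi)=|\{i\in\{1,\ldots,n-1\}:\pi(i)>\pi(i+1)\}|$, $\mathrm{des}_B(\pi)=|\{i\in\{0,\ldots,n-1\}:\pi(i)>\pi(i+1)\}|$ (with $\pi(0)=0$), and $\mathrm{fdes}(\pi)=\mathrm{des}_A(\pi)+\mathrm{des}_B(\pi)$. In the group algebra $\mathbb{Q}[\mathfrak{B}_n]$ put $A_i=\sum_{\mathrm{des}_A(\pi)=i}\pi$ for $0\le i\le n-1$ and $F_i=\sum_{\mathrm{fdes}(\pi)=i}\pi$ for $0\le i\le 2n-1$. Both spans are subalgebras of $\mathbb{Q}[\mathfrak{B}_n]$. *)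

theory Defs
  imports
    Complex_Main
    "HOL-Algebra.Ideal"
    "HOL-Combinatorics.Permutations"
    "HOL-Library.Function_Algebras"
begin

text \<open>
  A bijection of \<open>{-n, \<dots>, n}\<close> is represented by its extension to all integers by the identity
  (this is \<open>permutes\<close>), so that composition of the extensions is composition of the bijections.
\<close>

definition hyperoctahedral :: "nat \<Rightarrow> (int \<Rightarrow> int) monoid" where
  "hyperoctahedral n =
    \<lparr>carrier = {\<pi>. \<pi> permutes {- int n..int n} \<and> (\<forall>i\<in>{- int n..int n}. \<pi> (- i) = - \<pi> i)},
     monoid.mult = (\<circ>), one = id\<rparr>"

definition des_A :: "nat \<Rightarrow> (int \<Rightarrow> int) \<Rightarrow> nat" where
  "des_A n \<pi> = card {i \<in> {1..int n - 1}. \<pi> i > \<pi> (i + 1)}"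

definition des_B :: "nat \<Rightarrow> (int \<Rightarrow> int) \<Rightarrow> nat" where
  "des_B n \<pi> = card {i \<in> {0..int n - 1}. \<pi> i > \<pi> (i + 1)}"

definition fdes :: "nat \<Rightarrow> (int \<Rightarrow> int) \<Rightarrow> nat" where
  "fdes n \<pi> = des_A n \<pi> + des_B n \<pi>"

text \<open>
  Elements of the rational group algebra are given by their coefficient functions, which vanish
  outside the group. Multiplication is convolution; the definition is meant for finite groups
  only, where all functions have finite support and the sum is finite.
\<close>

definition group_algebra :: "('a, 'm) monoid_scheme \<Rightarrow> ('a \<Rightarrow> rat) ring" where
  "group_algebra G =
    \<lparr>carrier = {f. \<forall>x. x \<notin> carrier G \<longrightarrow> f x = 0},
     monoid.mult = (\<lambda>f g z.
       \<Sum>(x, y) \<in> {(x, y). x \<in> carrier G \<and> y \<in> carrier G \<and> x \<otimes>\<^bsub>G\<^esub> y = z}. f x * g y),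
     one = (\<lambda>x. of_bool (x = \<one>\<^bsub>G\<^esub>)),
     zero = 0,
     add = (+)\<rparr>"

definition rat_span :: "('a \<Rightarrow> rat) set \<Rightarrow> ('a \<Rightarrow> rat) set" where
  "rat_span = module.span (\<lambda>c f x. c * f x)"

definition A_elem :: "nat \<Rightarrow> nat \<Rightarrow> (int \<Rightarrow> int) \<Rightarrow> rat" where
  "A_elem n i = (\<lambda>\<pi>. of_bool (\<pi> \<in> carrier (hyperoctahedral n) \<and> des_A n \<pi> = i))"

definition F_elem :: "nat \<Rightarrow> nat \<Rightarrow> (int \<Rightarrow> int) \<Rightarrow> rat" where
  "F_elem n i = (\<lambda>\<pi>. of_bool (\<pi> \<in> carrier (hyperoctahedral n) \<and> fdes n \<pi> = i))"

definition eulerian_descent_A :: "nat \<Rightarrow> ((int \<Rightarrow> int) \<Rightarrow> rat) set" where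
  "eulerian_descent_A n = rat_span (A_elem n ` {0..n - 1})"

definition flag_descent :: "nat \<Rightarrow> ((int \<Rightarrow> int) \<Rightarrow> rat) set" where
  "flag_descent n = rat_span (F_elem n ` {0..2 * n - 1})"

definition flag_descent_algebra :: "nat \<Rightarrow> ((int \<Rightarrow> int) \<Rightarrow> rat) ring" where
  "flag_descent_algebra n = (group_algebra (hyperoctahedral n))\<lparr>carrier := flag_descent n\<rparr>"

lemma module_fun_rat: "module (\<lambda>(c::rat) (f::'a \<Rightarrow> rat) x. c * f x)"
  by unfold_locales (simp_all add: fun_eq_iff algebra_simps)

end

theory Submission
  imports Defs
begin

text \<open>
  Let \<open>\<Phi>\<^sub>m\<close> be the sum, over all odd words \<open>f\<close> on \<open>{-n, \<dots>, n}\<close> with letters in the symmetric chain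
  \<open>{-(m-1), -(m-3), \<dots>, m-1}\<close>, of the signed permutation sorting \<open>{-n, \<dots>, n}\<close> by the key
  \<open>(f i, i)\<close>. If \<open>f\<close> is sorted by \<open>x\<close> and \<open>g\<close> by \<open>y\<close>, the word \<open>f + m (g \<circ> x\<inverse>)\<close> is sorted by
  \<open>x \<circ> y\<close>; since letters of the chain for \<open>m k\<close> have unique balanced digits in base \<open>m\<close>, this gives
  \<open>\<Phi>\<^sub>m \<Phi>\<^sub>k = \<Phi>\<^sub>m\<^sub>k\<close>. The coefficient of \<open>\<pi>\<close> in \<open>\<Phi>\<^sub>m\<close> depends only on the flag descent number, for even
  \<open>m\<close> only on the type A descent number, and is unitriangular in it. Hence the \<open>\<Phi>\<^sub>m\<close> span the flag
  descent algebra, those with even \<open>m\<close> span the Eulerian one, and the even numbers absorb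
  multiplication.
\<close>

text \<open>HOL-Algebra claims the token \<open>inv\<close>, so the inverse of a function needs another name.\<close>
abbreviation (input) inv_fun :: "('a \<Rightarrow> 'b) \<Rightarrow> 'b \<Rightarrow> 'a" where
  "inv_fun f \<equiv> inv_into UNIV f"

section \<open>Signed permutations as odd permutations of the integers\<close>

lemma hyperoctahedral_iff:
  "\<pi> \<in> carrier (hyperoctahedral n) \<longleftrightarrow>
     \<pi> permutes {- int n..int n} \<and> (\<forall>i. \<pi> (- i) = - \<pi> i)" (is "?L \<longleftrightarrow> ?R")
proof
  assume L: ?L
  hence p: "\<pi> permutes {- int n..int n}"
    by (simp add: hyperoctahedral_def)
  have "\<pi> (- i) = - \<pi> i" for i
  proof (cases "i \<in> {- int n..int n}")
    case True
    with L show ?thesis by (simp add: hyperoctahedral_def)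
  next
    case False
    hence "- i \<notin> {- int n..int n}" by auto
    with False p show ?thesis by (metis permutes_not_in)
  qed
  with p show ?R by blast
next
  assume ?R
  thus ?L by (simp add: hyperoctahedral_def)
qed

lemma finite_hyperoctahedral: "finite (carrier (hyperoctahedral n))"
  by (rule finite_subset[OF _ finite_permutations[of "{- int n..int n}"]])
     (auto simp: hyperoctahedral_iff)

lemma hyperoctahedral_comp:
  assumes "x \<in> carrier (hyperoctahedral n)" "y \<in> carrier (hyperoctahedral n)"
  shows "x \<circ> y \<in> carrier (hyperoctahedral n)"
  using assms by (auto simp: hyperoctahedral_iff intro: permutes_compose)

lemma hyperoctahedral_inv_odd:
  assumes "x \<in> carrier (hyperoctahedral n)"
  shows "inv_fun x (- i) = - inv_fun x i"
  using assms by (metis hyperoctahedral_iff permutes_inv_eq)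

lemma hyperoctahedral_abs_le_iff:
  assumes "x \<in> carrier (hyperoctahedral n)"
  shows "\<bar>x i\<bar> \<le> int n \<longleftrightarrow> \<bar>i\<bar> \<le> int n"
proof -
  have "\<bar>k\<bar> \<le> int n \<longleftrightarrow> k \<in> {- int n..int n}" for k by auto
  thus ?thesis using assms permutes_in_image[of x "{- int n..int n}" i]
    by (simp only: hyperoctahedral_iff)
qed

lemma hyperoctahedral_zero:
  assumes "x \<in> carrier (hyperoctahedral n)"
  shows "x 0 = 0"
proof -
  have "x (- 0) = - x 0" using assms unfolding hyperoctahedral_iff by blast
  thus ?thesis by simp
qed

lemma hyperoctahedral_eq_0_iff:
  assumes "x \<in> carrier (hyperoctahedral n)"
  shows "x i = 0 \<longleftrightarrow> i = 0"
  using assms hyperoctahedral_zero[OF assms] unfolding hyperoctahedral_iff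
  by (metis permutes_inv_eq)

lemma hyperoctahedral_inv:
  assumes "x \<in> carrier (hyperoctahedral n)"
  shows "inv_fun x \<in> carrier (hyperoctahedral n)"
  using assms hyperoctahedral_inv_odd[OF assms] permutes_inv
  unfolding hyperoctahedral_iff by blast

section \<open>Sorting odd words\<close>

text \<open>Lexicographic comparison of the keys \<open>(f a, a)\<close>. Breaking ties by position
  makes the order total, so that a word with repeated letters still has only one sorting
  permutation.\<close>

definition less_key :: "(int \<Rightarrow> int) \<Rightarrow> int \<Rightarrow> int \<Rightarrow> bool" where
  "less_key f a b \<longleftrightarrow> f a < f b \<or> (f a = f b \<and> a < b)"

lemma less_key_trans: "less_key f a b \<Longrightarrow> less_key f b c \<Longrightarrow> less_key f a c"
  by (auto simp: less_key_def)

lemma less_key_irrefl: "\<not> less_key f a a"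
  by (auto simp: less_key_def)

lemma less_key_total: "a \<noteq> b \<Longrightarrow> less_key f a b \<or> less_key f b a"
  by (auto simp: less_key_def)

text \<open>Negation reverses both components of the key. This symmetry is what makes the sorting
  permutation odd.\<close>

lemma less_key_minus:
  assumes "\<And>i. f (- i) = - f i"
  shows "less_key f (- a) (- b) \<longleftrightarrow> less_key f b a"
  using assms by (auto simp: less_key_def)

definition sorts :: "nat \<Rightarrow> (int \<Rightarrow> int) \<Rightarrow> (int \<Rightarrow> int) \<Rightarrow> bool" where
  "sorts n f \<pi> \<longleftrightarrow> \<pi> \<in> carrier (hyperoctahedral n) \<and>
     (\<forall>i\<in>{- int n..int n}. \<forall>j\<in>{- int n..int n}. i < j \<longrightarrow> less_key f (\<pi> i) (\<pi> j))"

text \<open>Subtracting \<open>n\<close> centres the ranks, so that they run from \<open>- n\<close>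
  to \<open>n\<close>. On this interval the rank turns out to be the inverse of the sorting
  permutation.\<close>

definition key_rank :: "nat \<Rightarrow> (int \<Rightarrow> int) \<Rightarrow> int \<Rightarrow> int" where
  "key_rank n f a = int (card {b \<in> {- int n..int n}. less_key f b a}) - int n"

lemma key_rank_strict_mono:
  assumes "less_key f a b" "a \<in> {- int n..int n}"
  shows "key_rank n f a < key_rank n f b"
proof -
  have "{c \<in> {- int n..int n}. less_key f c a} \<subset> {c \<in> {- int n..int n}. less_key f c b}"
    using assms less_key_trans less_key_irrefl by blast
  hence "card {c \<in> {- int n..int n}. less_key f c a} < card {c \<in> {- int n..int n}. less_key f c b}"
    by (rule psubset_card_mono[OF finite_subset[of _ "{- int n..int n}"], rotated 2]) auto
  thus ?thesis by (simp add: key_rank_def)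
qed

lemma inj_on_key_rank: "inj_on (key_rank n f) {- int n..int n}"
  by (rule inj_onI) (metis key_rank_strict_mono less_key_total less_irrefl)

text \<open>A sorting permutation carries the \<open>n + i\<close> positions before \<open>i\<close>
  exactly onto the elements with a smaller key than \<open>\<pi> i\<close>.\<close>

lemma sorts_key_rank:
  assumes "sorts n f \<pi>" "i \<in> {- int n..int n}"
  shows "key_rank n f (\<pi> i) = i"
proof -
  let ?I = "{- int n..int n}"
  have p: "\<pi> permutes ?I" using assms(1) by (simp add: sorts_def hyperoctahedral_iff)
  have iff: "less_key f (\<pi> j) (\<pi> i) \<longleftrightarrow> j < i" if "j \<in> ?I" for j
    using assms that less_key_trans less_key_irrefl unfolding sorts_def
    by (metis linorder_neqE)
  have "{b \<in> ?I. less_key f b (\<pi> i)} = \<pi> ` {j \<in> ?I. j < i}"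
  proof (intro equalityI subsetI)
    fix b assume b: "b \<in> {b \<in> ?I. less_key f b (\<pi> i)}"
    then obtain j where "j \<in> ?I" "b = \<pi> j" using permutes_image[OF p] by blast
    with b iff show "b \<in> \<pi> ` {j \<in> ?I. j < i}" by blast
  next
    fix b assume "b \<in> \<pi> ` {j \<in> ?I. j < i}"
    thus "b \<in> {b \<in> ?I. less_key f b (\<pi> i)}" using iff permutes_image[OF p] by blast
  qed
  also have "{j \<in> ?I. j < i} = {- int n..<i}" using assms(2) by auto
  finally have "card {b \<in> ?I. less_key f b (\<pi> i)} = card {- int n..<i}"
    using permutes_inj_on[OF p] by (simp add: card_image)
  thus ?thesis using assms(2) by (simp add: key_rank_def)
qed

lemma sorts_unique:
  assumes "sorts n f \<pi>" "sorts n f \<sigma>"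
  shows "\<pi> = \<sigma>"
proof
  fix i
  have p: "\<pi> permutes {- int n..int n}" "\<sigma> permutes {- int n..int n}"
    using assms by (simp_all add: sorts_def hyperoctahedral_iff)
  show "\<pi> i = \<sigma> i"
  proof (cases "i \<in> {- int n..int n}")
    case True
    hence "key_rank n f (\<pi> i) = key_rank n f (\<sigma> i)"
      using assms sorts_key_rank by simp
    thus ?thesis using inj_on_key_rank True p by (metis inj_onD permutes_in_image)
  next
    case False
    with p show ?thesis by (metis permutes_not_in)
  qed
qed

text \<open>The rank, extended by the identity, is itself a signed permutation, and its inverse
  sorts \<open>f\<close>.\<close>

lemma sorts_exists:
  assumes odd: "\<And>i. f (- i) = - f i"
  obtains \<pi> where "sorts n f \<pi>"
proof -
  let ?I = "{- int n..int n}"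
  let ?r = "\<lambda>a. if a \<in> ?I then key_rank n f a else a"
  \<comment> \<open>The smaller and the larger elements together are the \<open>2 * n\<close>
    elements other than \<open>a\<close>. This gives both the range of the rank and, as negation
    swaps the two sets, its oddness.\<close>
  have total: "int (card {b \<in> ?I. less_key f b a}) + int (card {b \<in> ?I. less_key f a b}) = 2 * int n"
    if "a \<in> ?I" for a
  proof -
    have "?I - {a} = {b \<in> ?I. less_key f b a} \<union> {b \<in> ?I. less_key f a b}"
      using less_key_total less_key_irrefl by blast
    moreover have "card ({b \<in> ?I. less_key f b a} \<union> {b \<in> ?I. less_key f a b}) =
        card {b \<in> ?I. less_key f b a} + card {b \<in> ?I. less_key f a b}"
    proof (rule card_Un_disjoint)
      show "{b \<in> ?I. less_key f b a} \<inter> {b \<in> ?I. less_key f a b} = {}"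
        by (auto simp: less_key_def)
    qed (rule finite_subset[of _ ?I]; auto)+
    ultimately have "card {b \<in> ?I. less_key f b a} + card {b \<in> ?I. less_key f a b} = card ?I - 1"
      using that by (metis card_Diff_singleton)
    thus ?thesis by simp
  qed
  have range: "key_rank n f a \<in> ?I" if "a \<in> ?I" for a
    using total[OF that] unfolding key_rank_def atLeastAtMost_iff by linarith
  have "?r ` ?I \<subseteq> ?I"
  proof (rule image_subsetI)
    fix a assume "a \<in> ?I"
    thus "?r a \<in> ?I" using range[of a] by (simp only: if_True)
  qed
  moreover have inj: "inj_on ?r ?I"
    using inj_on_key_rank[of n f] by (subst inj_on_cong[of _ _ "key_rank n f"]) simp_all
  ultimately have "?r ` ?I = ?I"
    by (rule endo_inj_surj[OF finite_atLeastAtMost_int])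
  hence "bij_betw ?r ?I ?I"
    using inj unfolding bij_betw_def by blast
  hence p: "?r permutes ?I"
    by (rule bij_imp_permutes) (simp only: if_False)
  have r_odd: "?r (- a) = - ?r a" for a
  proof (cases "a \<in> ?I")
    case True
    have "{b \<in> ?I. less_key f b (- a)} = uminus ` {b \<in> ?I. less_key f a b}"
    proof (intro equalityI subsetI)
      fix b assume "b \<in> {b \<in> ?I. less_key f b (- a)}"
      hence "- b \<in> {b \<in> ?I. less_key f a b}"
        using less_key_minus[of f "- b" a] odd by simp
      thus "b \<in> uminus ` {b \<in> ?I. less_key f a b}" by (rule rev_image_eqI) simp
    next
      fix b assume "b \<in> uminus ` {b \<in> ?I. less_key f a b}"
      thus "b \<in> {b \<in> ?I. less_key f b (- a)}"
        using less_key_minus[of f] odd by auto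
    qed
    hence "card {b \<in> ?I. less_key f b (- a)} = card {b \<in> ?I. less_key f a b}"
      by (simp add: card_image)
    with total[OF True] True show ?thesis by (simp add: key_rank_def)
  next
    case False
    thus ?thesis by auto
  qed
  define \<pi> where "\<pi> = inv_fun ?r"
  have r: "?r \<in> carrier (hyperoctahedral n)"
    using p r_odd unfolding hyperoctahedral_iff by blast
  have G: "\<pi> \<in> carrier (hyperoctahedral n)"
    unfolding \<pi>_def by (rule hyperoctahedral_inv[OF r])
  have "less_key f (\<pi> i) (\<pi> j)" if ij: "i \<in> ?I" "j \<in> ?I" "i < j" for i j
  \<comment> \<open>The rank of \<open>\<pi> k\<close> is \<open>k\<close>, so a wrong order of keys
    would contradict the strict monotonicity of the rank.\<close>
  proof (rule ccontr)
    have I: "\<pi> i \<in> ?I" "\<pi> j \<in> ?I"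
      using G ij by (metis hyperoctahedral_iff permutes_in_image)+
    have ri: "key_rank n f (\<pi> k) = k" if "\<pi> k \<in> ?I" for k
      using permutes_inverses(1)[OF p, of k] that unfolding \<pi>_def[symmetric] by simp
    assume "\<not> less_key f (\<pi> i) (\<pi> j)"
    then consider "\<pi> i = \<pi> j" | "less_key f (\<pi> j) (\<pi> i)"
      using less_key_total by blast
    thus False
      using ri[OF I(1)] ri[OF I(2)] ij(3) key_rank_strict_mono[of f "\<pi> j" "\<pi> i" n] I
      by cases auto
  qed
  with G that show ?thesis unfolding sorts_def by blast
qed

section \<open>Odd words and their balanced digits\<close>

text \<open>Absolute value and parity together describe the symmetric chain of \<open>m\<close>
  letters. Position \<open>0\<close> is exempt: oddness forces the letter \<open>0\<close> there,
  which is in the chain only for odd \<open>m\<close>.\<close>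

definition words :: "nat \<Rightarrow> nat \<Rightarrow> (int \<Rightarrow> int) set" where
  "words n m = {f. (\<forall>i. f (- i) = - f i) \<and> (\<forall>i. int n < \<bar>i\<bar> \<longrightarrow> f i = 0) \<and>
     (\<forall>i. 0 < \<bar>i\<bar> \<and> \<bar>i\<bar> \<le> int n \<longrightarrow> \<bar>f i\<bar> < int m \<and> odd (f i + int m))}"

lemma words_zero: "f \<in> words n m \<Longrightarrow> f 0 = 0"
proof -
  assume "f \<in> words n m"
  hence "f (- 0) = - f 0" unfolding words_def by blast
  thus ?thesis by simp
qed

lemma words_odd: "f \<in> words n m \<Longrightarrow> f (- i) = - f i"
  by (simp add: words_def)

lemma words_outside: "f \<in> words n m \<Longrightarrow> int n < \<bar>i\<bar> \<Longrightarrow> f i = 0"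
  by (simp add: words_def)

lemma words_less: "f \<in> words n m \<Longrightarrow> m \<ge> 1 \<Longrightarrow> \<bar>f i\<bar> < int m"
  using words_zero[of f n m] by (cases "i = 0"; cases "\<bar>i\<bar> \<le> int n") (auto simp: words_def)

lemma finite_words: "finite (words n m)"
proof (rule finite_subset)
  show "words n m \<subseteq> {f. \<forall>i. (i \<in> {- int n..int n} \<longrightarrow> f i \<in> {- int m..int m}) \<and>
                      (i \<notin> {- int n..int n} \<longrightarrow> f i = 0)}"
  proof safe
    fix f i assume f: "f \<in> words n m" and i: "i \<in> {- int n..int n}"
    show "f i \<in> {- int m..int m}"
    proof (cases "i = 0")
      case True
      thus ?thesis using words_zero[OF f] by simp
    next
      case False
      hence "\<bar>f i\<bar> < int m" using f i by (auto simp: words_def)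
      thus ?thesis by auto
    qed
  next
    fix f i assume f: "f \<in> words n m" and i: "i \<notin> {- int n..int n}"
    thus "f i = 0" by (intro words_outside) auto
  qed
qed (intro finite_set_of_finite_funs; simp)

text \<open>Different high digits of equal parity differ by at least 2, which forces the low digits
  to differ by at least \<open>2 * m\<close>; but both lie strictly between \<open>- m\<close> and
  \<open>m\<close>.\<close>

lemma balanced_digits_unique:
  fixes a b a' b' :: int
  assumes "a + m * b = a' + m * b'" "\<bar>a\<bar> < m" "\<bar>a'\<bar> < m" "even (b - b')"
  shows "b = b'"
proof (rule ccontr)
  assume "b \<noteq> b'"
  with assms(4) have "\<bar>b - b'\<bar> \<ge> 2" by presburger
  hence "\<bar>m\<bar> * \<bar>b - b'\<bar> \<ge> \<bar>m\<bar> * 2" by (intro mult_left_mono) auto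
  moreover have "m * (b - b') = a' - a" using assms(1) by (simp add: algebra_simps)
  hence "\<bar>m\<bar> * \<bar>b - b'\<bar> = \<bar>a' - a\<bar>" by (metis abs_mult)
  ultimately show False using assms(2,3) by linarith
qed

text \<open>The substitution \<open>v = 2 * u + 1 - m * k\<close> identifies the chain with the
  integers from \<open>0\<close> to \<open>m * k - 1\<close>, where ordinary division of
  \<open>u\<close> by \<open>m\<close> yields the digits.\<close>

lemma balanced_digits_exist:
  fixes v m k :: int
  assumes "\<bar>v\<bar> < m * k" "odd (v + m * k)" "m > 0"
  obtains a b where "v = a + m * b" "\<bar>a\<bar> < m" "odd (a + m)" "\<bar>b\<bar> < k" "odd (b + k)"
proof -
  define u where "u = (v + m * k - 1) div 2"
  have u: "v = 2 * u + 1 - m * k"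
    using odd_two_times_div_two_succ[OF assms(2)] assms(2)
    unfolding u_def by (auto elim!: oddE)
  have u0: "0 \<le> u" "u < m * k" using assms(1) u by linarith+
  define q where "q = u div m"
  define r where "r = u mod m"
  have qr: "u = m * q + r" unfolding q_def r_def by simp
  have r: "0 \<le> r" "r < m" using assms(3) unfolding r_def by simp_all
  have q0: "0 \<le> q" using u0 assms(3) unfolding q_def by (simp add: pos_imp_zdiv_nonneg_iff)
  have "m * q < m * k" using u0 qr r by linarith
  hence qk: "q < k" using assms(3) by simp
  show ?thesis
  proof (rule that)
    show "v = (2 * r + 1 - m) + m * (2 * q + 1 - k)"
      using u qr by (simp add: algebra_simps)
    show "\<bar>2 * r + 1 - m\<bar> < m" using r by linarith
    show "\<bar>2 * q + 1 - k\<bar> < k" using q0 qk by linarith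
  qed simp_all
qed

text \<open>The digits are chosen separately at each position. Oddness of the two digit words comes
  from uniqueness, because the negated digits of \<open>h i\<close> are digits of
  \<open>h (- i)\<close>.\<close>

lemma words_decompose:
  assumes h: "h \<in> words n (m * k)" and "m \<ge> 1" "k \<ge> 1"
  obtains f b where "f \<in> words n m" "b \<in> words n k" "\<And>i. h i = f i + int m * b i"
proof -
  define P where "P i a b \<longleftrightarrow> h i = a + int m * b \<and> \<bar>a\<bar> < int m \<and> odd (a + int m) \<and>
     \<bar>b\<bar> < int k \<and> odd (b + int k)" for i a b
  have ex: "\<exists>a b. P i a b" if "0 < \<bar>i\<bar>" "\<bar>i\<bar> \<le> int n" for i
  proof -
    have "\<bar>h i\<bar> < int m * int k" "odd (h i + int m * int k)"
      using h that by (auto simp: words_def)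
    moreover have "int m > 0" using assms(2) by simp
    ultimately show ?thesis
      unfolding P_def by (rule balanced_digits_exist) blast
  qed
  have uniq: "a = a' \<and> b = b'" if "P i a b" "P i a' b'" for i a b a' b'
  proof -
    have "odd (b + int k)" "odd (b' + int k)" using that unfolding P_def by blast+
    hence "even (b - b')" by presburger
    hence "b = b'" using that balanced_digits_unique[of a "int m" b a' b']
      unfolding P_def by auto
    thus ?thesis using that unfolding P_def by auto
  qed
  have neg: "P (- i) (- a) (- b) " if "P i a b" for i a b
    using that words_odd[OF h] unfolding P_def by auto
  obtain f0 b0 where fb: "\<And>i. 0 < \<bar>i\<bar> \<Longrightarrow> \<bar>i\<bar> \<le> int n \<Longrightarrow> P i (f0 i) (b0 i)"
    using ex by metis
  \<comment> \<open>At \<open>0\<close> and outside the interval both digits are set to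
    \<open>0\<close>, as words require; \<open>h\<close> vanishes there too.\<close>
  define f where "f i = (if 0 < \<bar>i\<bar> \<and> \<bar>i\<bar> \<le> int n then f0 i else 0)" for i
  define b where "b i = (if 0 < \<bar>i\<bar> \<and> \<bar>i\<bar> \<le> int n then b0 i else 0)" for i
  have Pfb: "P i (f i) (b i)" if "0 < \<bar>i\<bar>" "\<bar>i\<bar> \<le> int n" for i
    using fb that by (simp add: f_def b_def)
  have odd: "f (- i) = - f i \<and> b (- i) = - b i" for i
  proof (cases "0 < \<bar>i\<bar> \<and> \<bar>i\<bar> \<le> int n")
    case True
    thus ?thesis using uniq[OF Pfb[of "- i"] neg[OF Pfb[of i]]] by simp
  next
    case False
    thus ?thesis by (auto simp: f_def b_def)
  qed
  show ?thesis
  proof (rule that)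
    show "f \<in> words n m" "b \<in> words n k"
      using odd Pfb unfolding words_def P_def by (auto simp: f_def b_def)
    show "h i = f i + int m * b i" for i
    proof (cases "0 < \<bar>i\<bar> \<and> \<bar>i\<bar> \<le> int n")
      case True
      thus ?thesis using Pfb unfolding P_def by blast
    next
      case False
      hence "i = 0 \<or> int n < \<bar>i\<bar>" by auto
      thus ?thesis using words_zero[OF h] words_outside[OF h] by (auto simp: f_def b_def)
    qed
  qed
qed

lemma words_parity_diff:
  assumes "b \<in> words n k" "b' \<in> words n k"
  shows "even (b i - b' i)"
proof (cases "0 < \<bar>i\<bar> \<and> \<bar>i\<bar> \<le> int n")
  case True
  hence "odd (b i + int k)" "odd (b' i + int k)" using assms by (auto simp: words_def)
  thus ?thesis by presburger
next
  case False
  hence "i = 0 \<or> int n < \<bar>i\<bar>" by auto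
  hence "b i = 0 \<and> b' i = 0"
    using words_zero[OF assms(1)] words_zero[OF assms(2)]
      words_outside[OF assms(1)] words_outside[OF assms(2)] by auto
  thus ?thesis by simp
qed

lemma words_decompose_unique:
  assumes "f \<in> words n m" "f' \<in> words n m" "b \<in> words n k" "b' \<in> words n k" "m \<ge> 1"
    and eq: "\<And>i. f i + int m * b i = f' i + int m * b' i"
  shows "f = f' \<and> b = b'"
proof -
  have "b = b'"
  proof
    fix i
    show "b i = b' i"
      by (rule balanced_digits_unique[OF eq words_less[OF assms(1,5)] words_less[OF assms(2,5)]
            words_parity_diff[OF assms(3,4)]])
  qed
  with eq show ?thesis by auto
qed

lemma words_compose:
  assumes f: "f \<in> words n m" and b: "b \<in> words n k" and m: "m \<ge> 1"
  shows "(\<lambda>i. f i + int m * b i) \<in> words n (m * k)"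
proof -
  have 1: "f (- i) + int m * b (- i) = - (f i + int m * b i)" for i
    using words_odd[OF f] words_odd[OF b] by simp
  have 2: "f i + int m * b i = 0" if "int n < \<bar>i\<bar>" for i
    using words_outside[OF f that] words_outside[OF b that] by simp
  have 3: "\<bar>f i + int m * b i\<bar> < int (m * k) \<and> odd (f i + int m * b i + int (m * k))"
    if "0 < \<bar>i\<bar>" "\<bar>i\<bar> \<le> int n" for i
  proof -
    have i: "\<bar>f i\<bar> < int m" "odd (f i + int m)" "\<bar>b i\<bar> < int k" "odd (b i + int k)"
      using that f b by (auto simp: words_def)
    have "\<bar>f i + int m * b i\<bar> \<le> \<bar>f i\<bar> + int m * \<bar>b i\<bar>"
      by (metis abs_triangle_ineq abs_mult abs_of_nat)
    also have "\<dots> \<le> \<bar>f i\<bar> + int m * (int k - 1)"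
      using i(3) by (intro add_left_mono mult_left_mono) auto
    also have "\<dots> < int m * int k" using i(1) by (simp add: algebra_simps)
    finally show ?thesis using i(2,4) by auto
  qed
  show ?thesis unfolding words_def using 1 2 3 by blast
qed

text \<open>The high digit decides. At nonzero positions high digits have equal parity, so a
  difference is at least 2 and its multiple by \<open>m\<close> outweighs the low digits. Position
  \<open>0\<close> is treated apart: the gap may be only 1, but one of the low digits is
  \<open>0\<close>.\<close>

lemma words_compose_mono:
  assumes f: "f \<in> words n m" and b: "b \<in> words n k" and m: "m \<ge> 1"
    and less: "b i < b j" and ij: "\<bar>i\<bar> \<le> int n" "\<bar>j\<bar> \<le> int n"
  shows "f i + int m * b i < f j + int m * b j"
proof -
  have fl: "\<bar>f i\<bar> < int m" "\<bar>f j\<bar> < int m" using words_less f m by auto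
  consider "i = 0" | "j = 0" | "i \<noteq> 0" "j \<noteq> 0" by blast
  thus ?thesis
  proof cases
    case 1
    hence "1 \<le> b j" using words_zero[OF b] less by simp
    hence "int m * 1 \<le> int m * b j" by (intro mult_left_mono) auto
    hence "0 < f j + int m * b j" using fl by linarith
    thus ?thesis using 1 words_zero[OF b] words_zero[OF f] by simp
  next
    case 2
    hence "b i \<le> - 1" using words_zero[OF b] less by simp
    hence "int m * b i \<le> int m * (- 1)" by (intro mult_left_mono) auto
    hence "f i + int m * b i < 0" using fl by linarith
    thus ?thesis using 2 words_zero[OF b] words_zero[OF f] by simp
  next
    case 3
    hence "odd (b i + int k)" "odd (b j + int k)" using b ij by (auto simp: words_def)
    hence "b i + 2 \<le> b j" using less by presburger
    hence "int m * (b i + 2) \<le> int m * b j" by (intro mult_left_mono) auto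
    thus ?thesis using fl by (simp add: algebra_simps)
  qed
qed

lemma words_comp:
  assumes g: "g \<in> words n k" and x: "x \<in> carrier (hyperoctahedral n)"
  shows "g \<circ> x \<in> words n k"
proof -
  have "0 < \<bar>x i\<bar> \<longleftrightarrow> 0 < \<bar>i\<bar>" for i
    using hyperoctahedral_eq_0_iff[OF x] by simp
  moreover have "x (- i) = - x i" for i using x by (simp add: hyperoctahedral_iff)
  ultimately show ?thesis
    using g hyperoctahedral_abs_le_iff[OF x]
    unfolding words_def by (auto simp: not_le[symmetric])
qed

text \<open>This is radix sort: \<open>x\<close> sorts by the low digit, then \<open>y\<close> sorts
  the rearranged high digits. Since \<open>y\<close> breaks ties by position, elements with equal
  high digit keep the order given by \<open>x\<close>.\<close>

lemma sorts_compose: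
  assumes f: "f \<in> words n m" "sorts n f x" and g: "b \<circ> x \<in> words n k" "sorts n (b \<circ> x) y"
    and b: "b \<in> words n k" and m: "m \<ge> 1"
  shows "sorts n (\<lambda>i. f i + int m * b i) (x \<circ> y)"
  unfolding sorts_def
proof (intro conjI ballI impI)
  have x: "x \<in> carrier (hyperoctahedral n)" and y: "y \<in> carrier (hyperoctahedral n)"
    using f g by (auto simp: sorts_def)
  show "x \<circ> y \<in> carrier (hyperoctahedral n)" using hyperoctahedral_comp[OF x y] .
  fix i j assume ij: "i \<in> {- int n..int n}" "j \<in> {- int n..int n}" "i < j"
  have yI: "\<bar>y i\<bar> \<le> int n" "\<bar>y j\<bar> \<le> int n"
    using ij hyperoctahedral_abs_le_iff[OF y] by auto
  hence xyI: "\<bar>x (y i)\<bar> \<le> int n" "\<bar>x (y j)\<bar> \<le> int n"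
    using hyperoctahedral_abs_le_iff[OF x] by auto
  have "less_key (b \<circ> x) (y i) (y j)" using g ij by (simp add: sorts_def)
  then consider "b (x (y i)) < b (x (y j))" | "b (x (y i)) = b (x (y j))" "y i < y j"
    by (auto simp: less_key_def)
  thus "less_key (\<lambda>i. f i + int m * b i) ((x \<circ> y) i) ((x \<circ> y) j)"
  proof cases
    case 1
    thus ?thesis using words_compose_mono[OF f(1) b m 1 xyI] by (simp add: less_key_def)
  next
    case 2
    hence "less_key f (x (y i)) (x (y j))"
      using f(2) yI unfolding sorts_def by (simp add: abs_le_iff minus_le_iff)
    thus ?thesis using 2(1) by (auto simp: less_key_def)
  qed
qed

section \<open>Products of word sums\<close>

definition words_sorted_by :: "nat \<Rightarrow> nat \<Rightarrow> (int \<Rightarrow> int) \<Rightarrow> (int \<Rightarrow> int) set" where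
  "words_sorted_by n m \<pi> = {f \<in> words n m. sorts n f \<pi>}"

lemma finite_words_sorted_by: "finite (words_sorted_by n m \<pi>)"
  using finite_words by (simp add: words_sorted_by_def)

text \<open>The coefficient function of \<open>\<Phi>\<^sub>m\<close>.\<close>

definition word_sum :: "nat \<Rightarrow> nat \<Rightarrow> (int \<Rightarrow> int) \<Rightarrow> rat" where
  "word_sum n m \<pi> = of_nat (card (words_sorted_by n m \<pi>))"

text \<open>At each \<open>z\<close> both coefficients count the same objects: a word for
  \<open>m * k\<close> sorted by \<open>z\<close> corresponds to a factorization of \<open>z\<close>
  together with one word sorted by each factor.\<close>

lemma word_sum_mult:
  assumes m: "m \<ge> 1" and k: "k \<ge> 1"
  shows "word_sum n m \<otimes>\<^bsub>group_algebra (hyperoctahedral n)\<^esub> word_sum n k = word_sum n (m * k)"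
proof
  fix z
  let ?G = "carrier (hyperoctahedral n)"
  let ?P = "{(x, y). x \<in> ?G \<and> y \<in> ?G \<and> x \<circ> y = z}"
  let ?W = "words_sorted_by n"
  let ?T = "SIGMA p:?P. ?W m (fst p) \<times> ?W k (snd p)"
  \<comment> \<open>Composing \<open>g\<close> with the inverse of \<open>x\<close> undoes the
    rearrangement by \<open>x\<close>, so both digits refer to the original positions.\<close>
  let ?h = "\<lambda>((x, y), (f, g)). \<lambda>i. f i + int m * g (inv_fun x i)"
  have finP: "finite ?P"
    by (rule finite_subset[of _ "?G \<times> ?G"]) (auto simp: finite_hyperoctahedral)
  have inv1: "inv_fun x (x i) = i" "x (inv_fun x i) = i" if "x \<in> ?G" for x i
    using that permutes_inverses unfolding hyperoctahedral_iff by metis+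
  have "bij_betw ?h ?T (?W (m * k) z)"
    unfolding bij_betw_def
  proof
    show "inj_on ?h ?T"
    proof (rule inj_onI, clarsimp)
      fix x y f g x' y' f' g'
      assume G: "x \<in> ?G" "y \<in> ?G" "x' \<in> ?G" "y' \<in> ?G" "x' \<circ> y' = x \<circ> y" "z = x \<circ> y"
        and fg: "f \<in> ?W m x" "g \<in> ?W k y" and fg': "f' \<in> ?W m x'" "g' \<in> ?W k y'"
        and eq: "(\<lambda>i. f i + int m * g (inv_fun x i)) = (\<lambda>i. f' i + int m * g' (inv_fun x' i))"
      have "g \<circ> inv_fun x \<in> words n k" "g' \<circ> inv_fun x' \<in> words n k"
        using words_comp hyperoctahedral_inv G fg fg' by (auto simp: words_sorted_by_def)
      moreover have "f \<in> words n m" "f' \<in> words n m"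
        using fg fg' by (auto simp: words_sorted_by_def)
      ultimately have f: "f = f'" "g \<circ> inv_fun x = g' \<circ> inv_fun x'"
        using words_decompose_unique[of f n m f' "g \<circ> inv_fun x" k "g' \<circ> inv_fun x'"] m fun_cong[OF eq]
        by auto
      \<comment> \<open>The low word determines \<open>x\<close>, then the high word determines
        \<open>g\<close>, and \<open>g\<close> determines \<open>y\<close>.\<close>
      hence x: "x = x'" using fg fg' sorts_unique unfolding words_sorted_by_def by blast
      have g: "g = g'"
        using fun_cong[OF f(2)] inv1(1)[OF G(1)] x by (metis comp_apply ext)
      hence "y = y'" using fg fg' sorts_unique unfolding words_sorted_by_def by blast
      with x f(1) g show "x = x' \<and> y = y' \<and> f = f' \<and> g = g'" by blast
    qed
    show "?h ` ?T = ?W (m * k) z"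
    proof (intro equalityI subsetI)
      fix h assume "h \<in> ?h ` ?T"
      then obtain x y f g where G: "x \<in> ?G" "y \<in> ?G" "z = x \<circ> y"
        and fg: "f \<in> ?W m x" "g \<in> ?W k y" and h: "h = (\<lambda>i. f i + int m * g (inv_fun x i))"
        by fastforce
      define b where "b = g \<circ> inv_fun x"
      have hb: "h = (\<lambda>i. f i + int m * b i)" using h by (simp add: b_def)
      have b: "b \<in> words n k"
        unfolding b_def
        using words_comp hyperoctahedral_inv G fg by (auto simp: words_sorted_by_def)
      have bx: "b \<circ> x = g" using inv1(1)[OF G(1)] by (auto simp: b_def)
      have "sorts n h (x \<circ> y)" unfolding hb
        by (rule sorts_compose[where k = k]) (use fg b m in \<open>auto simp: words_sorted_by_def bx\<close>)
      moreover have "h \<in> words n (m * k)" unfolding hb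
        by (rule words_compose) (use fg b m in \<open>auto simp: words_sorted_by_def\<close>)
      ultimately show "h \<in> ?W (m * k) z" using G by (simp add: words_sorted_by_def)
    next
      fix h assume h: "h \<in> ?W (m * k) z"
      then obtain f b where fb: "f \<in> words n m" "b \<in> words n k" "\<And>i. h i = f i + int m * b i"
        using words_decompose[of h n m k] m k unfolding words_sorted_by_def by blast
      have h_eq: "h = (\<lambda>i. f i + int m * b i)" using fb by auto
      \<comment> \<open>For surjectivity, \<open>x\<close> has to be the permutation sorting the low
        digits, and \<open>y\<close> the one sorting the high digits read along
        \<open>x\<close>.\<close>
      obtain x where x: "sorts n f x" using sorts_exists words_odd[OF fb(1)] by metis
      hence xG: "x \<in> ?G" by (simp add: sorts_def)
      have bx: "b \<circ> x \<in> words n k" using words_comp[OF fb(2) xG] .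
      obtain y where y: "sorts n (b \<circ> x) y" using sorts_exists words_odd[OF bx] by metis
      hence yG: "y \<in> ?G" by (simp add: sorts_def)
      have "sorts n h (x \<circ> y)" unfolding h_eq
        by (rule sorts_compose[OF fb(1) x bx y fb(2) m])
      hence xy: "x \<circ> y = z" using h sorts_unique by (auto simp: words_sorted_by_def)
      have "h = ?h ((x, y), (f, b \<circ> x))" using fb(3) inv1(2)[OF xG] by auto
      moreover have "((x, y), (f, b \<circ> x)) \<in> ?T"
        using x y xG yG xy fb bx by (auto simp: words_sorted_by_def)
      ultimately show "h \<in> ?h ` ?T" by blast
    qed
  qed
  hence "card (?W (m * k) z) = card ?T" by (simp add: bij_betw_same_card)
  also have "\<dots> = (\<Sum>p\<in>?P. card (?W m (fst p)) * card (?W k (snd p)))"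
    using finP by (subst card_SigmaI) (auto simp: finite_words_sorted_by card_cartesian_product)
  finally show "(word_sum n m \<otimes>\<^bsub>group_algebra (hyperoctahedral n)\<^esub> word_sum n k) z = word_sum n (m * k) z"
    by (simp add: word_sum_def group_algebra_def hyperoctahedral_def case_prod_unfold)
qed

section \<open>Counting the words sorted by a given signed permutation\<close>

text \<open>Transitivity reduces sorting to neighbouring positions, and oddness reduces those to the
  nonnegative ones.\<close>

lemma sorts_iff:
  assumes odd: "\<And>i. f (- i) = - f i" and G: "\<pi> \<in> carrier (hyperoctahedral n)"
  shows "sorts n f \<pi> \<longleftrightarrow> (\<forall>i\<in>{0..<int n}. less_key f (\<pi> i) (\<pi> (i + 1)))"
proof
  assume "sorts n f \<pi>"
  thus "\<forall>i\<in>{0..<int n}. less_key f (\<pi> i) (\<pi> (i + 1))" by (simp add: sorts_def)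
next
  assume step: "\<forall>i\<in>{0..<int n}. less_key f (\<pi> i) (\<pi> (i + 1))"
  have step': "less_key f (\<pi> i) (\<pi> (i + 1))" if "- int n \<le> i" "i < int n" for i
  proof (cases "i \<ge> 0")
    case True
    with step that show ?thesis by simp
  next
    case False
    \<comment> \<open>The step from \<open>i\<close> to \<open>i + 1\<close> is the mirror image of
      the step from \<open>- i - 1\<close> to \<open>- i\<close>.\<close>
    hence "less_key f (\<pi> (- i - 1)) (\<pi> (- i - 1 + 1))" using step[rule_format, of "- i - 1"] that by simp
    hence "less_key f (- \<pi> (- i - 1 + 1)) (- \<pi> (- i - 1))"
      using less_key_minus[of f] odd by blast
    moreover have "- \<pi> (- i - 1 + 1) = \<pi> i" "- \<pi> (- i - 1) = \<pi> (i + 1)"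
      using G unfolding hyperoctahedral_iff by (metis add.inverse_inverse diff_add_cancel)
        (metis G add.inverse_inverse hyperoctahedral_iff minus_add_distrib uminus_add_conv_diff diff_conv_add_uminus)
    ultimately show ?thesis by simp
  qed
  have "j \<le> int n \<longrightarrow> less_key f (\<pi> i) (\<pi> j)" if "- int n \<le> i" "i < j" for i j
    using that(2)
  proof (induction j rule: int_gr_induct)
    case base
    thus ?case using step' that(1) by auto
  next
    case (step k)
    thus ?case using step'[of k] that(1) less_key_trans[of f "\<pi> i" "\<pi> k"] by auto
  qed
  thus "sorts n f \<pi>" using G by (auto simp: sorts_def)
qed

section \<open>Monotone odd words with a bounded last letter\<close>

lemma mono_of_steps:
  fixes c :: "int \<Rightarrow> int"
  assumes "\<forall>i\<in>{0..<N}. c i \<le> c (i + 1)" "0 \<le> i" "i \<le> j" "j \<le> N"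
  shows "c i \<le> c j"
proof -
  have "j \<le> N \<longrightarrow> c i \<le> c j" using assms(3)
  proof (induction j rule: int_ge_induct)
    case base
    thus ?case by simp
  next
    case (step k)
    show ?case
    proof
      assume "k + 1 \<le> N"
      moreover from this have "c k \<le> c (k + 1)" using assms(1,2) step(1) by simp
      ultimately show "c i \<le> c (k + 1)" using step(2) by simp
    qed
  qed
  with assms(4) show ?thesis by blast
qed

text \<open>These are what remains of the sorted words once descents no longer matter. The bound
  \<open>t\<close> is an integer, since too many descents make it negative, and then no word is
  left.\<close>

definition monotone_words :: "nat \<Rightarrow> nat \<Rightarrow> int \<Rightarrow> (int \<Rightarrow> int) set" where
  "monotone_words n m t = {d. (\<forall>i. d (- i) = - d i) \<and> (\<forall>i. int n < \<bar>i\<bar> \<longrightarrow> d i = 0) \<and>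
     (\<forall>i. 0 < \<bar>i\<bar> \<and> \<bar>i\<bar> \<le> int n \<longrightarrow> odd (d i + int m)) \<and>
     (\<forall>i\<in>{0..<int n}. d i \<le> d (i + 1)) \<and> d (int n) \<le> t}"

lemma monotone_words_zero:
  assumes "d \<in> monotone_words n m t"
  shows "d 0 = 0"
proof -
  have "d (- 0) = - d 0" using assms unfolding monotone_words_def by blast
  thus ?thesis by simp
qed

lemma monotone_words_bounds:
  assumes "d \<in> monotone_words n m t" "0 \<le> i" "i \<le> int n"
  shows "0 \<le> d i" "d i \<le> t"
proof -
  have d: "\<forall>i\<in>{0..<int n}. d i \<le> d (i + 1)" "d (int n) \<le> t"
    using assms(1) by (simp_all add: monotone_words_def)
  show "0 \<le> d i" using mono_of_steps[OF d(1), of 0 i] assms(2,3) monotone_words_zero[OF assms(1)] by simp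
  show "d i \<le> t" using mono_of_steps[OF d(1), of i "int n"] assms d(2) by simp
qed

lemma monotone_words_empty: "t < 0 \<Longrightarrow> monotone_words n m t = {}"
  using monotone_words_bounds[of _ n m t 0] by force

text \<open>The letters at positive positions lie between \<open>0\<close> and \<open>t\<close>, and
  parity leaves only \<open>t\<close> itself. This supplies the ones on the diagonal.\<close>

lemma card_monotone_words_eq_1:
  assumes t: "t \<in> {0, 1}" "odd (t + int m)"
  shows "card (monotone_words n m t) = 1"
proof -
  let ?d = "\<lambda>i. if \<bar>i\<bar> \<le> int n then t * sgn i else 0"
  have "d = ?d" if d: "d \<in> monotone_words n m t" for d
  proof
    have pos: "d i = t" if "0 < i" "i \<le> int n" for i
    proof -
      have "odd (d i + int m)" using d that by (simp add: monotone_words_def)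
      hence "even (d i - t)" using t(2) by presburger
      moreover have "0 \<le> d i" "d i \<le> t" using monotone_words_bounds[OF d, of i] that by auto
      moreover have "t = 0 \<or> t = 1" using t(1) by simp
      ultimately show ?thesis by presburger
    qed
    fix i
    consider "i = 0" | "0 < i" "i \<le> int n" | "i < 0" "- i \<le> int n" | "int n < \<bar>i\<bar>"
      by linarith
    thus "d i = ?d i"
    proof cases
      case 1
      thus ?thesis using monotone_words_zero[OF d] by simp
    next
      case 2
      thus ?thesis using pos by simp
    next
      case 3
      moreover have "d (- i) = - d i" using d by (simp add: monotone_words_def)
      ultimately show ?thesis using pos[of "- i"] by simp
    next
      case 4
      thus ?thesis using d by (simp add: monotone_words_def)
    qed
  qed
  moreover have "?d \<in> monotone_words n m t"
  proof -
    have "odd (?d i + int m)" if "0 < \<bar>i\<bar>" "\<bar>i\<bar> \<le> int n" for i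
    proof -
      have "?d i = t \<or> ?d i = - t" using that by (auto simp: sgn_if)
      thus ?thesis using t(2) by presburger
    qed
    moreover have "?d i \<le> ?d (i + 1)" if "i \<in> {0..<int n}" for i
      using that t(1) by (auto simp: sgn_if)
    moreover have "?d (int n) \<le> t" using t(1) by (auto simp: sgn_if)
    ultimately show ?thesis using t(2) unfolding monotone_words_def by (simp add: sgn_minus)
  qed
  ultimately have "monotone_words n m t = {?d}" by blast
  thus ?thesis by simp
qed

text \<open>
  For even \<open>m\<close> a word has no letter \<open>0\<close> at a nonzero position, so a descent at position
  \<open>0\<close> imposes no condition.
\<close>

definition des_set :: "nat \<Rightarrow> nat \<Rightarrow> (int \<Rightarrow> int) \<Rightarrow> int set" where
  "des_set n m \<pi> = {i \<in> {(if even m then 1 else 0)..int n - 1}. \<pi> i > \<pi> (i + 1)}"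

text \<open>
  Subtracting twice the number of preceding descents turns the strict increases forced at descents
  into weak ones and preserves parities.
\<close>

definition shift :: "nat \<Rightarrow> nat \<Rightarrow> (int \<Rightarrow> int) \<Rightarrow> int \<Rightarrow> int" where
  "shift n m \<pi> i =
     (if \<bar>i\<bar> \<le> int n then sgn i * int (card {k \<in> des_set n m \<pi>. k < \<bar>i\<bar>}) else 0)"

lemma finite_des_set: "finite (des_set n m \<pi>)"
  unfolding des_set_def by (rule finite_subset[OF _ finite_atLeastAtMost_int]) blast

lemma shift_odd: "shift n m \<pi> (- i) = - shift n m \<pi> i"
  by (simp add: shift_def sgn_minus)

lemma shift_Suc:
  assumes "0 \<le> i" "i < int n"
  shows "shift n m \<pi> (i + 1) = shift n m \<pi> i + of_bool (i \<in> des_set n m \<pi>)"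
proof -
  let ?D = "\<lambda>i. {k \<in> des_set n m \<pi>. k < i}"
  have fin: "finite (?D i)" using finite_des_set by simp
  have "?D (i + 1) = (if i \<in> des_set n m \<pi> then insert i (?D i) else ?D i)"
    by (simp only: zless_add1_eq) auto
  hence "int (card (?D (i + 1))) = int (card (?D i)) + of_bool (i \<in> des_set n m \<pi>)"
    using fin by simp
  \<comment> \<open>At \<open>0\<close> the factor \<open>sgn\<close> makes the shift vanish, in
    agreement with the count because no descent precedes position \<open>0\<close>.\<close>
  moreover have "?D 0 = {}" by (auto simp: des_set_def split: if_splits)
  hence "card (?D 0) = 0" by (simp only: card.empty)
  ultimately show ?thesis using assms by (auto simp: shift_def sgn_if)
qed

lemma shift_last: "shift n m \<pi> (int n) = int (card (des_set n m \<pi>))"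
proof -
  have "{k \<in> des_set n m \<pi>. k < int n} = des_set n m \<pi>" by (auto simp: des_set_def)
  moreover have "n = 0 \<Longrightarrow> des_set n m \<pi> = {}" by (auto simp: des_set_def)
  ultimately show ?thesis by (cases "n = 0") (simp_all add: shift_def)
qed

text \<open>Read along \<open>\<pi>\<close>, a sorted word increases weakly, and strictly at
  descents, where equal parity raises the gap to 2. The largest letter \<open>m - 1\<close> loses 2
  for each descent.\<close>

lemma sorted_word_to_monotone:
  assumes m: "m \<ge> 1" and f: "f \<in> words n m" and s: "sorts n f \<pi>"
  shows "(\<lambda>i. f (\<pi> i) - 2 * shift n m \<pi> i)
           \<in> monotone_words n m (int m - 1 - 2 * int (card (des_set n m \<pi>)))"
proof -
  have G: "\<pi> \<in> carrier (hyperoctahedral n)" using s by (simp add: sorts_def)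
  define c where "c = f \<circ> \<pi>"
  have c: "c \<in> words n m" unfolding c_def by (rule words_comp[OF f G])
  let ?d = "\<lambda>i. c i - 2 * shift n m \<pi> i"
  have step: "?d i \<le> ?d (i + 1)" if i: "0 \<le> i" "i < int n" for i
  proof -
    have less: "less_key f (\<pi> i) (\<pi> (i + 1))"
      using s i by (simp add: sorts_iff[of f, OF words_odd[OF f] G])
    have "c i + 2 \<le> c (i + 1)" if D: "i \<in> des_set n m \<pi>"
    proof -
      have "c i < c (i + 1)" using less D by (auto simp: c_def less_key_def des_set_def)
      moreover have "odd (c (i + 1) + int m)" using c i by (simp add: words_def)
      \<comment> \<open>The letter \<open>0\<close> at position \<open>0\<close> has the common
        parity only for odd \<open>m\<close>; only then does \<open>des_set\<close> contain
        \<open>0\<close>.\<close>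
      moreover have "odd (c i + int m)"
      proof (cases "i = 0")
        case True
        hence "odd m" using D by (auto simp: des_set_def split: if_splits)
        thus ?thesis using True words_zero[OF c] by simp
      next
        case False
        thus ?thesis using c i by (simp add: words_def)
      qed
      ultimately show ?thesis by presburger
    qed
    moreover have "c i \<le> c (i + 1)" using less by (auto simp: c_def less_key_def)
    ultimately show ?thesis using shift_Suc[OF i, of m \<pi>] by auto
  qed
  have "?d (- i) = - ?d i" for i using words_odd[OF c] shift_odd by simp
  moreover have "?d i = 0" if "int n < \<bar>i\<bar>" for i
    using that words_outside[OF c that] by (simp add: shift_def)
  moreover have "odd (?d i + int m)" if "0 < \<bar>i\<bar>" "\<bar>i\<bar> \<le> int n" for i
  proof -
    have "odd (c i + int m)" using c that by (simp add: words_def)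
    thus ?thesis by presburger
  qed
  moreover have "?d (int n) \<le> int m - 1 - 2 * int (card (des_set n m \<pi>))"
    using words_less[OF c m, of "int n"] by (simp add: shift_last)
  ultimately have "?d \<in> monotone_words n m (int m - 1 - 2 * int (card (des_set n m \<pi>)))"
    using step unfolding monotone_words_def by simp
  thus ?thesis by (simp add: c_def)
qed

text \<open>Adding the shift back restores the strict increases at the members of
  \<open>des_set\<close>, and the inverse of \<open>\<pi>\<close> moves the letters back to their
  positions.\<close>

lemma monotone_to_sorted_word:
  assumes G: "\<pi> \<in> carrier (hyperoctahedral n)"
    and d: "d \<in> monotone_words n m (int m - 1 - 2 * int (card (des_set n m \<pi>)))"
  shows "(\<lambda>i. d (inv_fun \<pi> i) + 2 * shift n m \<pi> (inv_fun \<pi> i)) \<in> words_sorted_by n m \<pi>"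
proof -
  define c where "c i = d i + 2 * shift n m \<pi> i" for i
  have c_odd: "c (- i) = - c i" for i
    using d shift_odd unfolding monotone_words_def c_def by simp
  have c0: "c 0 = 0" using c_odd[of 0] by simp
  have c_parity: "odd (c i + int m)" if "0 < \<bar>i\<bar>" "\<bar>i\<bar> \<le> int n" for i
  proof -
    have "odd (d i + int m)" using d that by (simp add: monotone_words_def)
    thus ?thesis unfolding c_def by presburger
  qed
  have d_step: "d i \<le> d (i + 1)" if "0 \<le> i" "i < int n" for i
    using d that by (simp add: monotone_words_def)
  have c_step: "c i \<le> c (i + 1)" if "0 \<le> i" "i < int n" for i
    using d_step[OF that] shift_Suc[OF that, of m \<pi>] by (simp add: c_def)
  have c_strict: "c i < c (i + 1)" if i: "0 \<le> i" "i < int n" and D: "\<pi> i > \<pi> (i + 1)" for i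
  proof (cases "i \<in> des_set n m \<pi>")
    case True
    thus ?thesis using d_step[OF i] shift_Suc[OF i, of m \<pi>] by (simp add: c_def)
  next
    case False
    \<comment> \<open>The only descent missing from \<open>des_set\<close> is one at
      \<open>0\<close> for even \<open>m\<close>; there the increase is strict anyway, as
      \<open>c 1\<close> is odd.\<close>
    hence "i = 0" "even m" using i D by (auto simp: des_set_def split: if_splits)
    moreover from this have "odd (c 1)" using c_parity[of 1] i by simp
    hence "c 1 \<noteq> 0" by auto
    ultimately show ?thesis using c_step[OF i] c0 by simp
  qed
  have "c (int n) \<le> int m - 1"
    using d by (simp add: monotone_words_def c_def shift_last)
  moreover have c_mono: "0 \<le> i \<Longrightarrow> i \<le> j \<Longrightarrow> j \<le> int n \<Longrightarrow> c i \<le> c j" for i j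
    by (rule mono_of_steps[of "int n"]) (use c_step in auto)
  \<comment> \<open>On nonnegative positions the letters lie between \<open>c 0 = 0\<close> and the
    last letter, which is at most \<open>m - 1\<close>.\<close>
  ultimately have c_bound: "\<bar>c i\<bar> < int m" if "0 \<le> i" "i \<le> int n" for i
    using c_mono[OF order_refl that] c_mono[OF that order_refl] unfolding c0 by linarith
  have c_bound': "\<bar>c i\<bar> < int m" if "\<bar>i\<bar> \<le> int n" for i
    using c_bound[of "\<bar>i\<bar>"] c_odd[of i] that by (cases "i \<ge> 0") auto
  have "c i = 0" if "int n < \<bar>i\<bar>" for i
    using d that by (simp add: monotone_words_def c_def shift_def)
  hence c: "c \<in> words n m" using c_odd c_parity c_bound' by (simp add: words_def)
  define f where "f = c \<circ> inv_fun \<pi>"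
  have f: "f \<in> words n m" unfolding f_def by (rule words_comp[OF c hyperoctahedral_inv[OF G]])
  have f\<pi>: "f (\<pi> i) = c i" for i
    using G permutes_inverses(2) unfolding f_def hyperoctahedral_iff by fastforce
  have "less_key f (\<pi> i) (\<pi> (i + 1))" if "0 \<le> i" "i < int n" for i
  proof -
    have "\<pi> i \<noteq> \<pi> (i + 1)"
      using G permutes_inverses(2) unfolding hyperoctahedral_iff by (metis less_add_one less_irrefl)
    thus ?thesis using c_step[OF that] c_strict[OF that] unfolding less_key_def f\<pi> by linarith
  qed
  hence "sorts n f \<pi>" using sorts_iff[of f, OF words_odd[OF f] G] by simp
  with f have "f \<in> words_sorted_by n m \<pi>" by (simp add: words_sorted_by_def)
  thus ?thesis by (simp add: f_def c_def comp_def)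
qed

text \<open>The two preceding maps are mutually inverse. Hence the coefficient depends on
  \<open>\<pi>\<close> only through its number of descents.\<close>

lemma card_words_sorted_by:
  assumes G: "\<pi> \<in> carrier (hyperoctahedral n)" and m: "m \<ge> 1"
  shows "card (words_sorted_by n m \<pi>)
           = card (monotone_words n m (int m - 1 - 2 * int (card (des_set n m \<pi>))))" (is "_ = card ?M")
proof -
  let ?F = "\<lambda>f i. f (\<pi> i) - 2 * shift n m \<pi> i"
  let ?G = "\<lambda>d i. d (inv_fun \<pi> i) + 2 * shift n m \<pi> (inv_fun \<pi> i)"
  have p: "\<pi> permutes {- int n..int n}" using G by (simp add: hyperoctahedral_iff)
  note inv = permutes_inverses[OF p]
  have "\<forall>f\<in>words_sorted_by n m \<pi>. ?G (?F f) = f"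
    by (rule ballI) (simp only: inv diff_add_cancel)
  moreover have "\<forall>d\<in>?M. ?F (?G d) = d"
    by (rule ballI) (simp only: inv add_diff_cancel_right')
  moreover have "?F ` words_sorted_by n m \<pi> \<subseteq> ?M"
    by (rule image_subsetI, rule sorted_word_to_monotone[OF m]) (simp_all add: words_sorted_by_def)
  moreover have "?G ` ?M \<subseteq> words_sorted_by n m \<pi>"
    by (rule image_subsetI, rule monotone_to_sorted_word[OF G])
  ultimately have "bij_betw ?F (words_sorted_by n m \<pi>) ?M"
    by (rule bij_betw_byWitness)
  thus ?thesis by (rule bij_betw_same_card)
qed

section \<open>Descent numbers and the unitriangular coefficients\<close>

lemma card_des_set:
  "card (des_set n m \<pi>) = (if even m then des_A n \<pi> else des_B n \<pi>)"
  by (simp add: des_set_def des_A_def des_B_def)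

lemma des_B_eq:
  assumes "n \<ge> 1"
  shows "des_B n \<pi> = des_A n \<pi> + of_bool (\<pi> 0 > \<pi> 1)"
proof -
  let ?A = "{i \<in> {1..int n - 1}. \<pi> i > \<pi> (i + 1)}"
  have "{0..int n - 1} = insert 0 {1..int n - 1}" using assms by auto
  hence "{i \<in> {0..int n - 1}. \<pi> i > \<pi> (i + 1)} = (if \<pi> 0 > \<pi> 1 then insert 0 ?A else ?A)" by auto
  moreover have "finite ?A" by (rule finite_subset[OF _ finite_atLeastAtMost_int]) blast
  ultimately show ?thesis by (simp add: des_A_def des_B_def)
qed

text \<open>The two descent numbers differ by 0 or 1, so their sum determines both. This makes every
  coefficient a function of \<open>fdes\<close>.\<close>

lemma fdes_div_2:
  assumes "n \<ge> 1"
  shows "fdes n \<pi> div 2 = des_A n \<pi>" "(fdes n \<pi> + 1) div 2 = des_B n \<pi>"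
  using des_B_eq[OF assms, of \<pi>] by (auto simp: fdes_def)

lemma des_A_le: "des_A n \<pi> \<le> n - 1"
proof -
  have "des_A n \<pi> \<le> card {1..int n - 1}"
    unfolding des_A_def by (rule card_mono) auto
  thus ?thesis by simp
qed

lemma fdes_le:
  assumes "n \<ge> 1"
  shows "fdes n \<pi> \<le> 2 * n - 1"
  using des_B_eq[OF assms, of \<pi>] des_A_le[of n \<pi>] assms by (auto simp: fdes_def of_bool_def)

lemma word_sum_outside: "\<pi> \<notin> carrier (hyperoctahedral n) \<Longrightarrow> word_sum n m \<pi> = 0"
  by (simp add: word_sum_def words_sorted_by_def sorts_def)

text \<open>The coefficient of \<open>word_sum n (Suc j)\<close> at permutations with
  \<open>fdes\<close> equal to \<open>i\<close>. The index is \<open>m = j + 1\<close>, so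
  \<open>m\<close> is even exactly for odd \<open>j\<close>, where \<open>i div 2\<close> is the
  type A descent number.\<close>

definition coeff_F :: "nat \<Rightarrow> nat \<Rightarrow> nat \<Rightarrow> rat" where
  "coeff_F n j i = of_nat (card (monotone_words n (Suc j)
     (int j - 2 * int (if odd j then i div 2 else (i + 1) div 2))))"

definition coeff_A :: "nat \<Rightarrow> nat \<Rightarrow> nat \<Rightarrow> rat" where
  "coeff_A n j i = of_nat (card (monotone_words n (2 * Suc j) (2 * int j + 1 - 2 * int i)))"

text \<open>For \<open>i = j\<close> the bound is 1 or 0 according to the parity of
  \<open>j\<close>, and exactly one monotone word remains.\<close>

lemma coeff_F_diag: "coeff_F n j j = 1"
proof -
  have "int j - 2 * int (if odd j then j div 2 else (j + 1) div 2) = of_bool (odd j)"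
    by (auto elim!: oddE evenE)
  moreover have "card (monotone_words n (Suc j) (of_bool (odd j))) = 1"
    by (rule card_monotone_words_eq_1) auto
  ultimately show ?thesis unfolding coeff_F_def by (simp only: of_nat_1)
qed

text \<open>The bound is negative here, while every monotone word has the letter \<open>0\<close> at
  position \<open>0\<close>.\<close>

lemma coeff_F_above: "j < i \<Longrightarrow> coeff_F n j i = 0"
proof -
  assume "j < i"
  hence "int j - 2 * int (if odd j then i div 2 else (i + 1) div 2) < 0"
    by (cases "odd j") (simp_all, presburger+)
  thus ?thesis unfolding coeff_F_def by (simp only: monotone_words_empty card.empty of_nat_0)
qed

lemma coeff_A_diag: "coeff_A n j j = 1"
proof -
  have "card (monotone_words n (2 * Suc j) 1) = 1" by (rule card_monotone_words_eq_1) auto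
  thus ?thesis by (simp add: coeff_A_def)
qed

lemma coeff_A_above: "j < i \<Longrightarrow> coeff_A n j i = 0"
  by (simp add: coeff_A_def monotone_words_empty)

lemma word_sum_F:
  assumes "n \<ge> 1"
  shows "word_sum n (Suc j) = (\<lambda>\<pi>. \<Sum>i\<le>j. coeff_F n j i * F_elem n i \<pi>)"
proof
  fix \<pi>
  show "word_sum n (Suc j) \<pi> = (\<Sum>i\<le>j. coeff_F n j i * F_elem n i \<pi>)"
  proof (cases "\<pi> \<in> carrier (hyperoctahedral n)")
    case True
    have "word_sum n (Suc j) \<pi> = coeff_F n j (fdes n \<pi>)"
      using fdes_div_2[OF assms, of \<pi>]
      by (simp add: word_sum_def coeff_F_def card_words_sorted_by[OF True] card_des_set)
    \<comment> \<open>The sum may stop at \<open>j\<close>: if \<open>fdes n \<pi>\<close> exceeds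
      \<open>j\<close>, its coefficient is zero.\<close>
    also have "\<dots> = (\<Sum>i\<le>j. if i = fdes n \<pi> then coeff_F n j i else 0)"
      by (simp add: coeff_F_above)
    also have "\<dots> = (\<Sum>i\<le>j. coeff_F n j i * F_elem n i \<pi>)"
      by (rule sum.cong) (auto simp: F_elem_def True)
    finally show ?thesis .
  next
    case False
    thus ?thesis by (simp add: word_sum_outside F_elem_def)
  qed
qed

lemma word_sum_A:
  "word_sum n (2 * Suc j) = (\<lambda>\<pi>. \<Sum>i\<le>j. coeff_A n j i * A_elem n i \<pi>)"
proof
  fix \<pi>
  show "word_sum n (2 * Suc j) \<pi> = (\<Sum>i\<le>j. coeff_A n j i * A_elem n i \<pi>)"
  proof (cases "\<pi> \<in> carrier (hyperoctahedral n)")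
    case True
    have "word_sum n (2 * Suc j) \<pi> = coeff_A n j (des_A n \<pi>)"
      by (simp add: word_sum_def coeff_A_def card_words_sorted_by[OF True] card_des_set algebra_simps)
    also have "\<dots> = (\<Sum>i\<le>j. if i = des_A n \<pi> then coeff_A n j i else 0)"
      by (simp add: coeff_A_above)
    also have "\<dots> = (\<Sum>i\<le>j. coeff_A n j i * A_elem n i \<pi>)"
      by (rule sum.cong) (auto simp: A_elem_def True)
    finally show ?thesis .
  next
    case False
    thus ?thesis by (simp add: word_sum_outside A_elem_def)
  qed
qed

section \<open>The two algebras as spans of word sums\<close>

interpretation rat_fun: module "\<lambda>(c::rat) (f::'a \<Rightarrow> rat) x. c * f x"
  by (rule module_fun_rat)

lemma rat_fun_sum:
  "(\<Sum>i\<in>I. (\<lambda>x. c i * f i x)) = (\<lambda>x. \<Sum>i\<in>I. c i * f i x :: rat)"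
  by (induction I rule: infinite_finite_induct) (auto simp: fun_eq_iff)

text \<open>A unitriangular change of generators can be solved for \<open>E j\<close> by strong
  induction, since the remaining terms have smaller index.\<close>

lemma rat_span_triangular:
  fixes V E :: "nat \<Rightarrow> 'a \<Rightarrow> rat"
  assumes V: "\<And>j. V j = (\<lambda>x. \<Sum>i\<le>j. c j i * E i x)" and diag: "\<And>j. c j j = 1"
  shows "rat_span (range V) = rat_span (range E)"
proof -
  have "V j \<in> rat_fun.span (range E)" for j
    unfolding V rat_fun_sum[symmetric]
    by (intro rat_fun.span_sum rat_fun.span_scale rat_fun.span_base) simp
  moreover have "E j \<in> rat_fun.span (range V)" for j
  proof (induction j rule: less_induct)
    case (less j)
    have "V j = (\<lambda>x. (\<Sum>i<j. c j i * E i x) + E j x)"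
      unfolding V by (simp add: lessThan_Suc_atMost[symmetric] diag)
    hence "E j = V j - (\<Sum>i<j. (\<lambda>x. c j i * E i x))"
      unfolding rat_fun_sum by (simp add: fun_eq_iff)
    also have "\<dots> \<in> rat_fun.span (range V)"
      by (intro rat_fun.span_diff rat_fun.span_sum rat_fun.span_scale)
         (use less in \<open>auto intro: rat_fun.span_base\<close>)
    finally show ?case .
  qed
  ultimately show ?thesis unfolding rat_span_def by (subst rat_fun.span_eq) blast
qed

text \<open>As \<open>F_elem n i\<close> vanishes for large \<open>i\<close>, the generators may be
  indexed by all naturals. The triangular change then yields all word sums with
  \<open>m \<ge> 1\<close>, a family closed under multiplication.\<close>

lemma flag_descent_eq:
  assumes "n \<ge> 1"
  shows "flag_descent n = rat_span {word_sum n m |m. m \<ge> 1}"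
proof -
  have zero: "F_elem n i = 0" if "i > 2 * n - 1" for i
  proof -
    have "fdes n \<pi> \<noteq> i" for \<pi> using fdes_le[OF assms, of \<pi>] that by simp
    thus ?thesis by (simp add: F_elem_def fun_eq_iff)
  qed
  have "F_elem n i \<in> rat_fun.span (F_elem n ` {0..2 * n - 1})" for i
    by (cases "i \<le> 2 * n - 1") (auto simp: zero rat_fun.span_zero intro: rat_fun.span_base)
  moreover have "F_elem n ` {0..2 * n - 1} \<subseteq> rat_fun.span (range (F_elem n))"
    by (auto intro: rat_fun.span_base)
  ultimately have "flag_descent n = rat_span (range (F_elem n))"
    unfolding flag_descent_def rat_span_def by (subst rat_fun.span_eq) blast
  also have "\<dots> = rat_span (range (\<lambda>j. word_sum n (Suc j)))"
    by (rule rat_span_triangular[symmetric, OF word_sum_F[OF assms] coeff_F_diag])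
  also have "range (\<lambda>j. word_sum n (Suc j)) = {word_sum n m |m. m \<ge> 1}"
  proof (intro equalityI subsetI)
    fix x assume "x \<in> {word_sum n m |m. m \<ge> 1}"
    then obtain m where "x = word_sum n m" "m \<ge> 1" by blast
    thus "x \<in> range (\<lambda>j. word_sum n (Suc j))" by (intro range_eqI[of _ _ "m - 1"]) simp
  qed auto
  finally show ?thesis .
qed

lemma eulerian_descent_A_eq:
  assumes "n \<ge> 1"
  shows "eulerian_descent_A n = rat_span {word_sum n m |m. m \<ge> 1 \<and> even m}"
proof -
  have zero: "A_elem n i = 0" if "i > n - 1" for i
  proof -
    have "des_A n \<pi> \<noteq> i" for \<pi> using des_A_le[of n \<pi>] that by simp
    thus ?thesis by (simp add: A_elem_def fun_eq_iff)
  qed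
  have "A_elem n i \<in> rat_fun.span (A_elem n ` {0..n - 1})" for i
    by (cases "i \<le> n - 1") (auto simp: zero rat_fun.span_zero intro: rat_fun.span_base)
  moreover have "A_elem n ` {0..n - 1} \<subseteq> rat_fun.span (range (A_elem n))"
    by (auto intro: rat_fun.span_base)
  ultimately have "eulerian_descent_A n = rat_span (range (A_elem n))"
    unfolding eulerian_descent_A_def rat_span_def by (subst rat_fun.span_eq) blast
  also have "\<dots> = rat_span (range (\<lambda>j. word_sum n (2 * Suc j)))"
    by (rule rat_span_triangular[symmetric, OF word_sum_A coeff_A_diag])
  also have "range (\<lambda>j. word_sum n (2 * Suc j)) = {word_sum n m |m. m \<ge> 1 \<and> even m}"
  proof (intro equalityI subsetI)
    fix x assume "x \<in> {word_sum n m |m. m \<ge> 1 \<and> even m}"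
    then obtain m where x: "x = word_sum n m" "m \<ge> 1" "even m" by blast
    \<comment> \<open>Even \<open>m \<ge> 1\<close> are exactly the values
      \<open>2 * Suc j\<close>.\<close>
    hence "m = 2 * Suc (m div 2 - 1)" by (auto elim!: evenE)
    thus "x \<in> range (\<lambda>j. word_sum n (2 * Suc j))" using x(1) by (metis rangeI)
  next
    fix x assume "x \<in> range (\<lambda>j. word_sum n (2 * Suc j))"
    then obtain j where "x = word_sum n (2 * Suc j)" by blast
    moreover have "2 * Suc j \<ge> 1" "even (2 * Suc j)" by simp_all
    ultimately show "x \<in> {word_sum n m |m. m \<ge> 1 \<and> even m}" by blast
  qed
  finally show ?thesis .
qed

text \<open>The only letter for \<open>m = 1\<close> is \<open>0\<close>, and by the tie-breaking
  rule the zero word is sorted by the identity.\<close>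

lemma word_sum_1: "word_sum n 1 = \<one>\<^bsub>group_algebra (hyperoctahedral n)\<^esub>"
proof
  fix \<pi>
  have "words n 1 \<subseteq> {\<lambda>_. 0}"
    using words_less[of _ n 1] by fastforce
  moreover have "(\<lambda>_. 0) \<in> words n 1" by (simp add: words_def)
  ultimately have words: "words n 1 = {\<lambda>_. 0}" by blast
  have id: "sorts n (\<lambda>_. 0) id"
    by (auto simp: sorts_def less_key_def hyperoctahedral_iff permutes_id)
  have "words_sorted_by n 1 \<pi> = (if \<pi> = id then {\<lambda>_. 0} else {})"
    using id sorts_unique[OF id] unfolding words_sorted_by_def words by auto
  thus "word_sum n 1 \<pi> = \<one>\<^bsub>group_algebra (hyperoctahedral n)\<^esub> \<pi>"
    by (simp add: word_sum_def group_algebra_def hyperoctahedral_def)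
qed

section \<open>The ideal\<close>

lemma group_algebra_mult_add_left:
  "(x + y) \<otimes>\<^bsub>group_algebra G\<^esub> z = x \<otimes>\<^bsub>group_algebra G\<^esub> z + y \<otimes>\<^bsub>group_algebra G\<^esub> z"
  by (simp add: group_algebra_def fun_eq_iff case_prod_unfold distrib_right sum.distrib)

lemma group_algebra_mult_add_right:
  "z \<otimes>\<^bsub>group_algebra G\<^esub> (x + y) = z \<otimes>\<^bsub>group_algebra G\<^esub> x + z \<otimes>\<^bsub>group_algebra G\<^esub> y"
  by (simp add: group_algebra_def fun_eq_iff case_prod_unfold distrib_left sum.distrib)

lemma group_algebra_mult_scale_left:
  "(\<lambda>a. c * x a) \<otimes>\<^bsub>group_algebra G\<^esub> y = (\<lambda>a. c * (x \<otimes>\<^bsub>group_algebra G\<^esub> y) a)"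
  by (simp add: group_algebra_def fun_eq_iff case_prod_unfold sum_distrib_left mult.assoc)

lemma group_algebra_mult_scale_right:
  "y \<otimes>\<^bsub>group_algebra G\<^esub> (\<lambda>a. c * x a) = (\<lambda>a. c * (y \<otimes>\<^bsub>group_algebra G\<^esub> x) a)"
  by (simp add: group_algebra_def fun_eq_iff case_prod_unfold sum_distrib_left mult.left_commute)

lemma group_algebra_mult_zero_left: "0 \<otimes>\<^bsub>group_algebra G\<^esub> y = 0"
  by (simp add: group_algebra_def fun_eq_iff case_prod_unfold)

lemma group_algebra_mult_zero_right: "y \<otimes>\<^bsub>group_algebra G\<^esub> 0 = 0"
  by (simp add: group_algebra_def fun_eq_iff case_prod_unfold)

lemmas group_algebra_bilinear =
  group_algebra_mult_add_left group_algebra_mult_add_right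
  group_algebra_mult_scale_left group_algebra_mult_scale_right
  group_algebra_mult_zero_left group_algebra_mult_zero_right

section \<open>From generators to spans by bilinearity\<close>

lemma rat_span_induct [consumes 1, case_names zero add scale base]:
  assumes "x \<in> rat_span S"
    and "P 0" and "\<And>x y. P x \<Longrightarrow> P y \<Longrightarrow> P (x + y)" and "\<And>c x. P x \<Longrightarrow> P (\<lambda>a. c * x a)"
    and "\<And>x. x \<in> S \<Longrightarrow> P x"
  shows "P x"
  using assms(1) unfolding rat_span_def
proof (induction rule: rat_fun.span_induct)
  case base
  show ?case using assms(2-4) by (auto intro!: rat_fun.subspaceI)
next
  case (step x)
  thus ?case by (rule assms(5))
qed

lemma rat_span_zero: "0 \<in> rat_span S"
  unfolding rat_span_def by (rule rat_fun.span_zero)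

lemma rat_span_add: "x \<in> rat_span S \<Longrightarrow> y \<in> rat_span S \<Longrightarrow> x + y \<in> rat_span S"
  unfolding rat_span_def by (rule rat_fun.span_add)

lemma rat_span_neg: "x \<in> rat_span S \<Longrightarrow> - x \<in> rat_span S"
  unfolding rat_span_def by (rule rat_fun.span_neg)

lemma rat_span_scale: "x \<in> rat_span S \<Longrightarrow> (\<lambda>a. c * x a) \<in> rat_span S"
  unfolding rat_span_def by (rule rat_fun.span_scale)

lemma rat_span_base: "x \<in> S \<Longrightarrow> x \<in> rat_span S"
  unfolding rat_span_def by (rule rat_fun.span_base)

lemma rat_span_mult:
  assumes "x \<in> rat_span S" "y \<in> rat_span T"
    and "\<And>s t. s \<in> S \<Longrightarrow> t \<in> T \<Longrightarrow> s \<otimes>\<^bsub>group_algebra G\<^esub> t \<in> rat_span U"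
  shows "x \<otimes>\<^bsub>group_algebra G\<^esub> y \<in> rat_span U"
  using assms(1)
proof (induction rule: rat_span_induct)
  case (base s)
  show ?case
    using assms(2)
  proof (induction rule: rat_span_induct)
    case (base t)
    show ?case by (rule assms(3)[OF \<open>s \<in> S\<close> base])
  qed (simp_all only: group_algebra_bilinear rat_span_zero rat_span_add rat_span_scale)
qed (simp_all only: group_algebra_bilinear rat_span_zero rat_span_add rat_span_scale)

lemma rat_span_commute:
  assumes "x \<in> rat_span S" "y \<in> rat_span T"
    and "\<And>s t. s \<in> S \<Longrightarrow> t \<in> T \<Longrightarrow> s \<otimes>\<^bsub>group_algebra G\<^esub> t = t \<otimes>\<^bsub>group_algebra G\<^esub> s"
  shows "x \<otimes>\<^bsub>group_algebra G\<^esub> y = y \<otimes>\<^bsub>group_algebra G\<^esub> x"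
  using assms(1)
proof (induction rule: rat_span_induct)
  case (base s)
  show ?case
    using assms(2)
  proof (induction rule: rat_span_induct)
    case (base t)
    show ?case by (rule assms(3)[OF \<open>s \<in> S\<close> base])
  qed (simp_all only: group_algebra_bilinear)
qed (simp_all only: group_algebra_bilinear)

lemma rat_span_assoc:
  assumes "x \<in> rat_span S" "y \<in> rat_span S" "z \<in> rat_span S"
    and "\<And>s t u. s \<in> S \<Longrightarrow> t \<in> S \<Longrightarrow> u \<in> S \<Longrightarrow>
      (s \<otimes>\<^bsub>group_algebra G\<^esub> t) \<otimes>\<^bsub>group_algebra G\<^esub> u = s \<otimes>\<^bsub>group_algebra G\<^esub> (t \<otimes>\<^bsub>group_algebra G\<^esub> u)"
  shows "(x \<otimes>\<^bsub>group_algebra G\<^esub> y) \<otimes>\<^bsub>group_algebra G\<^esub> z = x \<otimes>\<^bsub>group_algebra G\<^esub> (y \<otimes>\<^bsub>group_algebra G\<^esub> z)"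
  using assms(1)
proof (induction rule: rat_span_induct)
  case s: (base s)
  show ?case
    using assms(2)
  proof (induction rule: rat_span_induct)
    case t: (base t)
    show ?case
      using assms(3)
    proof (induction rule: rat_span_induct)
      case (base u)
      show ?case by (rule assms(4)[OF s t base])
    qed (simp_all only: group_algebra_bilinear)
  qed (simp_all only: group_algebra_bilinear)
qed (simp_all only: group_algebra_bilinear)

lemma rat_span_left_neutral:
  assumes "x \<in> rat_span S" and "\<And>s. s \<in> S \<Longrightarrow> e \<otimes>\<^bsub>group_algebra G\<^esub> s = s"
  shows "e \<otimes>\<^bsub>group_algebra G\<^esub> x = x"
  using assms(1) by (induction rule: rat_span_induct) (simp_all only: group_algebra_bilinear assms(2))

text \<open>On word sums the product multiplies indices, so associativity, commutativity and the
  unit law are inherited from the natural numbers and extend to the span by bilinearity.\<close>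

lemma cring_flag_descent_algebra:
  assumes "n \<ge> 1"
  shows "cring (flag_descent_algebra n)"
proof -
  let ?G = "hyperoctahedral n"
  let ?W = "{word_sum n m |m. m \<ge> 1}"
  have mult: "x \<otimes>\<^bsub>flag_descent_algebra n\<^esub> y = x \<otimes>\<^bsub>group_algebra ?G\<^esub> y"
    and add: "x \<oplus>\<^bsub>flag_descent_algebra n\<^esub> y = x + y"
    and one: "\<one>\<^bsub>flag_descent_algebra n\<^esub> = \<one>\<^bsub>group_algebra ?G\<^esub>"
    and zero: "\<zero>\<^bsub>flag_descent_algebra n\<^esub> = 0"
    and carrier: "carrier (flag_descent_algebra n) = rat_span ?W" for x y
    by (simp_all add: flag_descent_algebra_def group_algebra_def flag_descent_eq[OF assms])
  note simps = mult add one zero carrier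
  show ?thesis
  proof (rule cringI)
    show "abelian_group (flag_descent_algebra n)"
      by (rule abelian_groupI)
         (auto simp: simps rat_span_add rat_span_zero add_ac
            intro!: bexI[of _ "- x" for x] rat_span_neg)
    show "Group.comm_monoid (flag_descent_algebra n)"
    proof (rule comm_monoidI, unfold simps)
      fix x y z assume xyz: "x \<in> rat_span ?W" "y \<in> rat_span ?W" "z \<in> rat_span ?W"
      show "x \<otimes>\<^bsub>group_algebra ?G\<^esub> y \<otimes>\<^bsub>group_algebra ?G\<^esub> z
          = x \<otimes>\<^bsub>group_algebra ?G\<^esub> (y \<otimes>\<^bsub>group_algebra ?G\<^esub> z)"
        using xyz by (rule rat_span_assoc) (auto simp: word_sum_mult mult.assoc)
    next
      fix x y assume xy: "x \<in> rat_span ?W" "y \<in> rat_span ?W"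
      show "x \<otimes>\<^bsub>group_algebra ?G\<^esub> y = y \<otimes>\<^bsub>group_algebra ?G\<^esub> x"
        using xy by (rule rat_span_commute) (auto simp: word_sum_mult mult.commute)
      show "x \<otimes>\<^bsub>group_algebra ?G\<^esub> y \<in> rat_span ?W"
        using xy by (rule rat_span_mult) (force simp: word_sum_mult intro: rat_span_base)
    next
      fix x assume x: "x \<in> rat_span ?W"
      show "\<one>\<^bsub>group_algebra ?G\<^esub> \<otimes>\<^bsub>group_algebra ?G\<^esub> x = x"
        using x unfolding word_sum_1[symmetric]
        by (rule rat_span_left_neutral) (auto simp: word_sum_mult)
    next
      show "\<one>\<^bsub>group_algebra ?G\<^esub> \<in> rat_span ?W"
        unfolding word_sum_1[symmetric] by (rule rat_span_base) auto
    qed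
  qed (simp only: simps group_algebra_bilinear)
qed

text \<open>A product of two indices is even as soon as one factor is. Hence multiplying by any word
  sum, on either side, keeps the span of those with even index.\<close>

theorem mainTheorem5:
  fixes n :: nat
  assumes "n \<ge> 1"
  shows "ideal (eulerian_descent_A n) (flag_descent_algebra n)"
proof -
  let ?G = "hyperoctahedral n"
  let ?W = "{word_sum n m |m. m \<ge> 1}"
  let ?E = "{word_sum n m |m. m \<ge> 1 \<and> even m}"
  interpret F: cring "flag_descent_algebra n"
    by (rule cring_flag_descent_algebra[OF assms])
  have mult: "x \<otimes>\<^bsub>flag_descent_algebra n\<^esub> y = x \<otimes>\<^bsub>group_algebra ?G\<^esub> y"
    and add: "x \<oplus>\<^bsub>flag_descent_algebra n\<^esub> y = x + y"
    and zero: "\<zero>\<^bsub>flag_descent_algebra n\<^esub> = 0"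
    and carrier: "carrier (flag_descent_algebra n) = rat_span ?W" for x y
    by (simp_all add: flag_descent_algebra_def group_algebra_def flag_descent_eq[OF assms])
  note simps = mult add zero carrier eulerian_descent_A_eq[OF assms]
  have subset: "rat_span ?E \<subseteq> rat_span ?W"
    unfolding rat_span_def by (rule rat_fun.span_mono) blast
  show ?thesis
  proof (rule idealI)
    show "ring (flag_descent_algebra n)" by (rule F.ring_axioms)
    show "subgroup (eulerian_descent_A n) (add_monoid (flag_descent_algebra n))"
    proof (rule F.add.subgroupI, unfold simps)
      show "rat_span ?E \<subseteq> rat_span ?W" by (rule subset)
      show "rat_span ?E \<noteq> {}" using rat_span_zero by blast
    next
      fix x assume x: "x \<in> rat_span ?E"
      \<comment> \<open>The additive inverse of the ring is characterized abstractly and must first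
        be identified with pointwise negation.\<close>
      have "\<ominus>\<^bsub>flag_descent_algebra n\<^esub> x = - x"
        by (rule F.minus_equality) (use x subset rat_span_neg in \<open>auto simp: simps\<close>)
      thus "\<ominus>\<^bsub>flag_descent_algebra n\<^esub> x \<in> rat_span ?E" using rat_span_neg[OF x] by simp
    next
      fix x y assume "x \<in> rat_span ?E" "y \<in> rat_span ?E"
      thus "x + y \<in> rat_span ?E" by (rule rat_span_add)
    qed
  next
    fix a x assume "a \<in> eulerian_descent_A n" "x \<in> carrier (flag_descent_algebra n)"
    hence ax: "a \<in> rat_span ?E" "x \<in> rat_span ?W" by (simp_all only: simps)
    show "x \<otimes>\<^bsub>flag_descent_algebra n\<^esub> a \<in> eulerian_descent_A n"
      unfolding simps using ax(2,1) by (rule rat_span_mult) (force simp: word_sum_mult intro: rat_span_base)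
    show "a \<otimes>\<^bsub>flag_descent_algebra n\<^esub> x \<in> eulerian_descent_A n"
      unfolding simps using ax by (rule rat_span_mult) (force simp: word_sum_mult intro: rat_span_base)
  qed
qed

end
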